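(* Let the parameter $x$ be drawn from the Gaussian distribution $\mathcal{X}=\mathcal{N}(\mu,\Sigma)$ on $\mathbf{R}^n$. Let $a^k_j\in\mathbf{R}^n$ be (the transpose of) the $j$-th row of the matrix $$-(I-\theta^{k-1}\mathrm{diag}(\lambda))\cdots(I-\theta^0\mathrm{diag}(\lambda))\,\mathrm{diag}(\lambda)^{-1}Q^T,$$ and let $\bar z^k_j=\left((a^k_j)^T\mu\right)^2+(a^k_j)^T\Sigma a^k_j$ for $j=1,\dots,n$. Then for every integer $B\ge1$ the stochastic $B$-step lookahead problem $$\text{minimize}\quad r(\theta^k,\dots,\theta^{k+B-1})=\mathbf{E}_{x\sim\mathcal{X}}\left\|(I-\theta^{k+B-1}P)\cdots(I-\theta^kP)\left(z^k_\theta(x)-z^\star(x)\right)\right\|_2^2$$ can be written as the deterministic problem $$\text{minimize}\quad r(\theta^k,\dots,\theta^{k+B-1})=\sum_{j=1}^n(1-\theta^k\lambda_j)^2\cdots(1-\theta^{k+B-1}\lambda_j)^2\,\bar z^k_j .$$ Hence, with $a=\sum_j\lambda_j\bar z^k_j$, $b=\sum_j\lambda_j^2\bar z^k_j$, $c=\sum_j\lambda_j^3\bar z^k_j$, $d=\sum_j\lambda_j^4\bar z^k_j$, $e=\sum_j\lambda_j^5\bar z^k_j$, $f=\sum_j\lambda_j^6\bar z^k_j$: (i) ($B=2$) if at least two of the $\bar z^k_j$ are non-zero with distinct corresponding eigenvalues $\lambda_j$, then the two-step optimal step sizes $(\theta^k,\theta^{k+1})$ (global minimizers of the stochastic problem)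 are the two values $$\frac{ad-bc\pm\sqrt{(bc-ad)^2-4(ac-b^2)(bd-c^2)}}{2(bd-c^2)}$$ in either order, and they are non-negative; (ii) ($B=3$) if at least three of the $\bar z^k_j$ are non-zero with pairwise distinct corresponding eigenvalues $\lambda_j$, then the three-step optimal step sizes $(\theta^k,\theta^{k+1},\theta^{k+2})$ (global minimizers of the stochastic problem) are the three roots, in any order, all of them real, of the cubic $d_3t^3+d_2t^2+d_1t+d_0=0$ with $$\begin{aligned}d_0&=ace-b^2e-ad^2+2bcd-c^3,\\ d_1&=c^2d-bd^2-bce+ade+b^2f-acf,\\ d_2&=-cd^2+c^2e+bde-ae^2-bcf+adf,\\ d_3&=d^3-2cde+be^2+c^2f-bdf.\end{aligned}$$
   Context: Let $P\in\mathbf{R}^{n\times n}$ be symmetric positive definite with eigendecomposition $P=Q\,\mathrm{diag}(\lambda)Q^T$, $Q$ orthogonal, $\lambda_1,\dots,\lambda_n>0$. For a parameter $x\in\mathbf{R}^n$ consider the problem of minimizing $(1/2)z^TPz+x^Tz$ over $z\in\mathbf{R}^n$, with solution $z^\star(x)=-P^{-1}x$. Given an integer $k\ge0$ and previously fixed (deterministic) step sizes $\theta^0,\dots,\theta^{k-1}\in\mathbf{R}$, $z^k_\theta(x)$ is the gradient descent iterate defined by $z^0_\theta(x)=0$ and $z^{l+1}_\theta(x)=z^l_\theta(x)-\theta^l(Pz^l_\theta(x)+x)$. The decision variables of the lookahead problem are $\theta^k,\dots,\theta^{k+B-1}\in\mathbf{R}$. *)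

theory Defs
  imports "HOL-Probability.Probability" "HOL-Library.Multiset"
begin

unbundle inner_syntax

definition diag_matrix :: "real^'n \<Rightarrow> real^'n^'n" where
  "diag_matrix v = (\<chi> i j. if i = j then v $ i else 0)"

definition sym_pos_def :: "real^'n^'n \<Rightarrow> bool" where
  "sym_pos_def A \<longleftrightarrow> transpose A = A \<and> (\<forall>z. z \<noteq> 0 \<longrightarrow> z \<bullet> (A *v z) > 0)"

definition sym_pos_semidef :: "real^'n^'n \<Rightarrow> bool" where
  "sym_pos_semidef A \<longleftrightarrow> transpose A = A \<and> (\<forall>z. z \<bullet> (A *v z) \<ge> 0)"

(* Parameterised by mean m and variance v (not standard deviation); for v = 0 it is a point mass. *)
definition normal_law :: "real \<Rightarrow> real \<Rightarrow> real measure" where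
  "normal_law m v =
     (if v = 0 then return borel m
      else density lborel (\<lambda>t. ennreal (normal_density m (sqrt v) t)))"

(* M is the law N(mu, Sigma): every linear functional of the random vector is univariate normal
   with the corresponding mean and variance.  A singular Sigma is allowed. *)
definition gaussian_law :: "(real^'n) measure \<Rightarrow> real^'n \<Rightarrow> real^'n^'n \<Rightarrow> bool" where
  "gaussian_law M \<mu> \<Sigma> \<longleftrightarrow>
     prob_space M \<and> sets M = sets borel \<and> sym_pos_semidef \<Sigma> \<and>
     (\<forall>v. distr M borel (\<lambda>x. v \<bullet> x) = normal_law (v \<bullet> \<mu>) (v \<bullet> (\<Sigma> *v v)))"

definition qp_objective :: "real^'n^'n \<Rightarrow> real^'n \<Rightarrow> real^'n \<Rightarrow> real" where
  "qp_objective P x z = (1/2) * (z \<bullet> (P *v z)) + x \<bullet> z"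

definition qp_solution :: "real^'n^'n \<Rightarrow> real^'n \<Rightarrow> real^'n" where
  "qp_solution P x = - (matrix_inv P *v x)"

lemma qp_solution_unique_minimizer:
  assumes P: "sym_pos_def P"
  shows "is_arg_min (qp_objective P x) (\<lambda>_. True) z \<longleftrightarrow> z = qp_solution P x"
proof -
  define s where "s = qp_solution P x"
  have "P *v z = 0 \<Longrightarrow> z = 0" for z
    using P unfolding sym_pos_def_def by (metis inner_zero_right less_irrefl)
  then have "invertible P"
    by (simp add: invertible_left_inverse matrix_left_invertible_ker)
  then have "P ** matrix_inv P = mat 1"
    unfolding invertible_def matrix_inv_def by (metis (mono_tags, lifting) someI_ex)
  then have s: "P *v s = - x"
    by (simp add: s_def qp_solution_def matrix_vector_mul_assoc
        linear_neg[OF matrix_vector_mul_linear])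
  have diff: "qp_objective P x y - qp_objective P x s = (1/2) * ((y - s) \<bullet> (P *v (y - s)))" for y
  proof -
    have "s \<bullet> (P *v y) = (P *v s) \<bullet> y"
      using P by (metis dot_lmul_matrix sym_pos_def_def transpose_matrix_vector)
    then show ?thesis
      by (simp add: qp_objective_def matrix_vector_mult_diff_distrib inner_diff_left
          inner_diff_right s inner_commute algebra_simps)
  qed
  have lt: "qp_objective P x s < qp_objective P x y" if "y \<noteq> s" for y
  proof -
    have "(y - s) \<bullet> (P *v (y - s)) > 0"
      using P that by (simp add: sym_pos_def_def)
    then show ?thesis using diff[of y] by simp
  qed
  show ?thesis
    unfolding is_arg_min_def s_def[symmetric] using lt by (metis less_asym)
qed

primrec gd_iterate :: "real^'n^'n \<Rightarrow> (nat \<Rightarrow> real) \<Rightarrow> real^'n \<Rightarrow> nat \<Rightarrow> real^'n" where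
  "gd_iterate P \<theta> x 0 = 0"
| "gd_iterate P \<theta> x (Suc l) =
     gd_iterate P \<theta> x l - \<theta> l *\<^sub>R (P *v gd_iterate P \<theta> x l + x)"

(* step_product M [t_0, ..., t_m] = (I - t_m M) ** ... ** (I - t_0 M) *)
primrec step_product :: "real^'n^'n \<Rightarrow> real list \<Rightarrow> real^'n^'n" where
  "step_product M [] = mat 1"
| "step_product M (t # ts) = step_product M ts ** (mat 1 - t *\<^sub>R M)"

(* The step sizes chosen by the lookahead problem, theta^k, ..., theta^(k+B-1), are the entries
   of the list ts, of length B; only the first k values of the sequence \<theta> are used. *)
definition lookahead_error ::
    "real^'n^'n \<Rightarrow> (nat \<Rightarrow> real) \<Rightarrow> nat \<Rightarrow> real list \<Rightarrow> real^'n \<Rightarrow> real" where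
  "lookahead_error P \<theta> k ts x =
     (norm (step_product P ts *v (gd_iterate P \<theta> x k - qp_solution P x)))\<^sup>2"

definition lookahead_risk ::
    "real^'n^'n \<Rightarrow> (real^'n) measure \<Rightarrow> (nat \<Rightarrow> real) \<Rightarrow> nat \<Rightarrow> real list \<Rightarrow> real" where
  "lookahead_risk P X \<theta> k ts = (LINT x|X. lookahead_error P \<theta> k ts x)"

definition lookahead_minimizers ::
    "real^'n^'n \<Rightarrow> (real^'n) measure \<Rightarrow> (nat \<Rightarrow> real) \<Rightarrow> nat \<Rightarrow> nat \<Rightarrow> real list set" where
  "lookahead_minimizers P X \<theta> k B =
     {ts. is_arg_min (lookahead_risk P X \<theta> k) (\<lambda>ts. length ts = B) ts}"

definition error_row ::
    "real^'n^'n \<Rightarrow> real^'n \<Rightarrow> (nat \<Rightarrow> real) \<Rightarrow> nat \<Rightarrow> 'n \<Rightarrow> real^'n" where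
  "error_row Q lam \<theta> k j =
     row j (- (step_product (diag_matrix lam) (map \<theta> [0..<k])
               ** matrix_inv (diag_matrix lam) ** transpose Q))"

definition zbar ::
    "real^'n^'n \<Rightarrow> real^'n \<Rightarrow> real^'n \<Rightarrow> real^'n^'n \<Rightarrow> (nat \<Rightarrow> real) \<Rightarrow> nat \<Rightarrow> 'n \<Rightarrow> real" where
  "zbar Q lam \<mu> \<Sigma> \<theta> k j =
     (let a = error_row Q lam \<theta> k j in (a \<bullet> \<mu>)\<^sup>2 + a \<bullet> (\<Sigma> *v a))"

end

theory Submission
  imports Defs
begin

text \<open>
  In the eigenbasis of \<open>P\<close> the error decouples, so the expected loss is a second moment of each
  coordinate: \<open>\<Sum>\<^sub>j w\<^sub>j q(x\<^sub>j)\<^sup>2\<close> with nodes \<open>x\<^sub>j\<close> (the eigenvalues), weights \<open>w\<^sub>j\<close> and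
  \<open>q(y) = \<Prod>\<^sub>i (1 - t\<^sub>i y)\<close>. Among all polynomials of degree at most \<open>B\<close> with \<open>q(0) = 1\<close> this is a strictly
  convex quadratic, minimized exactly when \<open>q\<close> is orthogonal to \<open>y, \<dots>, y\<^sup>B\<close>. Hence \<open>q\<close> is an
  orthogonal polynomial for the positive weights \<open>w\<^sub>j x\<^sub>j\<close>, so it has only positive real roots and
  really is of the form \<open>\<Prod>\<^sub>i (1 - t\<^sub>i y)\<close>; Cramer's rule for the orthogonality relations gives the
  stated coefficients.
\<close>

lemma invertible_matrix_inv_right:
  fixes A :: "real^'n^'n"
  assumes "invertible A" shows "A ** matrix_inv A = mat 1"
  using assms unfolding invertible_def matrix_inv_def by (metis (mono_tags, lifting) someI_ex)

lemma sym_pos_def_invertible: "sym_pos_def P \<Longrightarrow> invertible P"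
  unfolding invertible_left_inverse matrix_left_invertible_ker sym_pos_def_def
  by (metis inner_zero_right less_irrefl)

lemma diag_matrix_vector_nth: "(diag_matrix v *v x) $ j = v $ j * x $ j"
  by (simp add: diag_matrix_def matrix_vector_mult_def if_distrib[of "\<lambda>y. y * _"] cong: if_cong)

lemma diag_matrix_invertible:
  assumes "\<And>j. v $ j \<noteq> 0" shows "invertible (diag_matrix v)"
  unfolding invertible_left_inverse matrix_left_invertible_ker
  using assms by (metis diag_matrix_vector_nth mult_eq_0_iff vec_eq_iff zero_index)

lemma diag_matrix_inv_vector_nth:
  assumes "\<And>j. v $ j \<noteq> 0"
  shows "(matrix_inv (diag_matrix v) *v x) $ j = x $ j / v $ j"
proof -
  have "diag_matrix v *v (matrix_inv (diag_matrix v) *v x) = x"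
    using invertible_matrix_inv_right[OF diag_matrix_invertible[of v]] assms
    by (simp add: matrix_vector_mul_assoc)
  then have "v $ j * (matrix_inv (diag_matrix v) *v x) $ j = x $ j"
    by (metis diag_matrix_vector_nth)
  then show ?thesis using assms[of j] by (simp add: field_simps)
qed

lemma step_matrix_vector: "(mat 1 - t *\<^sub>R M) *v x = x - t *\<^sub>R (M *v (x :: real^'n))"
  by (simp add: matrix_vector_mult_diff_rdistrib scaleR_matrix_vector_assoc)

lemma step_product_snoc: "step_product M (ts @ [t]) = (mat 1 - t *\<^sub>R M) ** step_product M ts"
  by (induction ts) (simp_all add: matrix_mul_assoc)

lemma step_product_diagonalize:
  assumes T: "T ** M = diag_matrix v ** T"
  shows "(T *v (step_product M ts *v x)) $ j = (\<Prod>t\<leftarrow>ts. 1 - t * v $ j) * (T *v x) $ j"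
proof (induction ts arbitrary: x)
  case (Cons t ts)
  have "(T *v (M *v x)) $ j = v $ j * (T *v x) $ j"
    using T by (metis matrix_vector_mul_assoc diag_matrix_vector_nth)
  then have "(T *v (x - t *\<^sub>R (M *v x))) $ j = (1 - t * v $ j) * (T *v x) $ j"
    by (simp add: matrix_vector_mult_diff_distrib matrix_vector_mult_scaleR algebra_simps)
  then show ?case
    by (simp add: Cons step_matrix_vector flip: matrix_vector_mul_assoc)
qed simp

lemma gd_iterate_error:
  assumes "P *v s = - x"
  shows "gd_iterate P \<theta> x k - s = step_product P (map \<theta> [0..<k]) *v (- s)"
proof (induction k)
  case (Suc k)
  have "gd_iterate P \<theta> x (Suc k) - s
      = (mat 1 - \<theta> k *\<^sub>R P) *v (gd_iterate P \<theta> x k - s)"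
    by (simp add: step_matrix_vector matrix_vector_mult_diff_distrib assms scaleR_add_right)
  then show ?case
    by (simp only: Suc step_product_snoc matrix_vector_mul_assoc upt_Suc_append[OF le0] map_append list.map)
qed simp

lemma normal_law_second_moment:
  assumes "v \<ge> 0"
  shows "has_bochner_integral (normal_law m v) (\<lambda>t. t\<^sup>2) (m\<^sup>2 + v)"
proof (cases "v = 0")
  case True
  then show ?thesis
    by (simp add: normal_law_def has_bochner_integral_iff integrable_iff_bounded
        nn_integral_return integral_return)
next
  case False
  with assms have s: "sqrt v > 0" by simp
  let ?g = "normal_density m (sqrt v)"
  have "has_bochner_integral lborel (\<lambda>x. ?g x * (x - m)\<^sup>2) v"
    using normal_moment_even[OF s, of m 1] assms by simp
  moreover have "has_bochner_integral lborel (\<lambda>x. 2 * m * (?g x * x)) (2 * m * m)"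
    by (intro has_bochner_integral_mult_right normal_moment_nz_1 s)
  moreover have "has_bochner_integral lborel (\<lambda>x. m\<^sup>2 * ?g x) (m\<^sup>2 * 1)"
    using s by (intro has_bochner_integral_mult_right) (simp add: has_bochner_integral_iff)
  ultimately have "has_bochner_integral lborel
      (\<lambda>x. ?g x * (x - m)\<^sup>2 + 2 * m * (?g x * x) - m\<^sup>2 * ?g x) (v + 2 * m * m - m\<^sup>2 * 1)"
    by (intro has_bochner_integral_add has_bochner_integral_diff)
  also have "(\<lambda>x. ?g x * (x - m)\<^sup>2 + 2 * m * (?g x * x) - m\<^sup>2 * ?g x) = (\<lambda>x. ?g x *\<^sub>R x\<^sup>2)"
    by (simp add: fun_eq_iff power2_eq_square algebra_simps)
  also have "v + 2 * m * m - m\<^sup>2 * 1 = m\<^sup>2 + v"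
    by (simp add: power2_eq_square)
  finally show ?thesis
    using False by (simp add: normal_law_def has_bochner_integral_density)
qed

lemma gaussian_law_second_moment:
  assumes "gaussian_law X \<mu> \<Sigma>"
  shows "has_bochner_integral X (\<lambda>x. (v \<bullet> x)\<^sup>2) ((v \<bullet> \<mu>)\<^sup>2 + v \<bullet> (\<Sigma> *v v))"
proof -
  have sets: "sets X = sets borel" and psd: "v \<bullet> (\<Sigma> *v v) \<ge> 0"
    and law: "distr X borel (\<lambda>x. v \<bullet> x) = normal_law (v \<bullet> \<mu>) (v \<bullet> (\<Sigma> *v v))"
    using assms by (auto simp: gaussian_law_def sym_pos_semidef_def)
  have m: "(\<lambda>x. v \<bullet> x) \<in> measurable X borel"
    unfolding measurable_cong_sets[OF sets refl] by simp
  show ?thesis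
    using normal_law_second_moment[OF psd, of "v \<bullet> \<mu>"] m
    by (simp add: has_bochner_integral_iff integrable_distr_eq integral_distr flip: law)
qed

lemma lookahead_error_eq:
  assumes P: "sym_pos_def P" and Q: "orthogonal_matrix Q"
    and eig: "P = Q ** diag_matrix lam ** transpose Q" and lam: "\<And>j. lam $ j > 0"
  shows "lookahead_error P \<theta> k ts x =
    (\<Sum>j\<in>UNIV. (\<Prod>t\<leftarrow>ts. 1 - t * lam $ j)\<^sup>2 * (error_row Q lam \<theta> k j \<bullet> x)\<^sup>2)"
proof -
  define T where "T = transpose Q"
  define s where "s = qp_solution P x"
  let ?\<Lambda> = "diag_matrix lam" and ?past = "map \<theta> [0..<k]"
  have TQ: "T ** Q = mat 1" "Q ** T = mat 1"
    using Q by (simp_all add: T_def orthogonal_matrix_def)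
  have TP: "T ** P = ?\<Lambda> ** T"
    using TQ by (simp add: eig T_def[symmetric] matrix_mul_assoc)
  have nz: "lam $ j \<noteq> 0" for j using lam[of j] by simp
  have Ps: "P *v s = - x"
    using invertible_matrix_inv_right[OF sym_pos_def_invertible[OF P]]
    by (simp add: s_def qp_solution_def matrix_vector_mul_assoc
        linear_neg[OF matrix_vector_mul_linear])
  have row: "error_row Q lam \<theta> k j \<bullet> x = - ((\<Prod>t\<leftarrow>?past. 1 - t * lam $ j) * ((T *v x) $ j / lam $ j))"
    for j
  proof -
    have "error_row Q lam \<theta> k j \<bullet> x = - ((step_product ?\<Lambda> ?past ** matrix_inv ?\<Lambda> ** T) *v x) $ j"
      by (simp add: error_row_def row_def T_def matrix_vector_mult_def inner_vec_def sum_negf)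
    also have "\<dots> = - (mat 1 *v (step_product ?\<Lambda> ?past *v (matrix_inv ?\<Lambda> *v (T *v x)))) $ j"
      by (simp add: matrix_vector_mul_assoc matrix_mul_assoc)
    also have "\<dots> = - ((\<Prod>t\<leftarrow>?past. 1 - t * lam $ j) * ((T *v x) $ j / lam $ j))"
      by (subst step_product_diagonalize[where v = lam])
         (simp_all add: diag_matrix_inv_vector_nth nz)
    finally show ?thesis .
  qed
  have "lam $ j * (T *v s) $ j = - (T *v x) $ j" for j
  proof -
    have "T *v (P *v s) = ?\<Lambda> *v (T *v s)"
      by (simp add: matrix_vector_mul_assoc TP)
    then show ?thesis
      by (metis Ps diag_matrix_vector_nth linear_neg matrix_vector_mul_linear vector_uminus_component)
  qed
  then have Ts: "(T *v (- s)) $ j = (T *v x) $ j / lam $ j" for j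
    using nz[of j] by (simp add: linear_neg[OF matrix_vector_mul_linear] field_simps)
  have err: "(T *v (step_product P ts *v (gd_iterate P \<theta> x k - s))) $ j
      = - (\<Prod>t\<leftarrow>ts. 1 - t * lam $ j) * (error_row Q lam \<theta> k j \<bullet> x)" for j
    unfolding gd_iterate_error[OF Ps] step_product_diagonalize[OF TP] Ts row by simp
  have isometry: "y \<bullet> y = (T *v y) \<bullet> (T *v y)" for y
    using TQ by (metis T_def dot_lmul_matrix matrix_vector_mul_assoc matrix_vector_mul_lid transpose_matrix_vector)
  have "lookahead_error P \<theta> k ts x =
      (\<Sum>j\<in>UNIV. ((T *v (step_product P ts *v (gd_iterate P \<theta> x k - s))) $ j)\<^sup>2)"
    unfolding lookahead_error_def s_def[symmetric] power2_norm_eq_inner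
    by (subst isometry) (simp add: inner_vec_def power2_eq_square)
  then show ?thesis
    by (simp add: err power_mult_distrib)
qed

lemma lookahead_error_has_integral:
  assumes "sym_pos_def P" "orthogonal_matrix Q"
    and "P = Q ** diag_matrix lam ** transpose Q" "\<And>j. lam $ j > 0"
    and X: "gaussian_law X \<mu> \<Sigma>"
  shows "has_bochner_integral X (lookahead_error P \<theta> k ts)
    (\<Sum>j\<in>UNIV. (\<Prod>t\<leftarrow>ts. 1 - t * lam $ j)\<^sup>2 * zbar Q lam \<mu> \<Sigma> \<theta> k j)"
  unfolding lookahead_error_eq[OF assms(1-4), abs_def] zbar_def Let_def
  by (intro has_bochner_integral_sum has_bochner_integral_mult_right gaussian_law_second_moment[OF X])

lemma zbar_nonneg: "gaussian_law X \<mu> \<Sigma> \<Longrightarrow> zbar Q lam \<mu> \<Sigma> \<theta> k j \<ge> 0"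
  by (simp add: zbar_def Let_def gaussian_law_def sym_pos_semidef_def)

definition residual_poly :: "real list \<Rightarrow> real poly" where
  "residual_poly ts = (\<Prod>t\<leftarrow>ts. [:1, - t:])"

lemma residual_poly_Nil [simp]: "residual_poly [] = 1"
  and residual_poly_Cons [simp]: "residual_poly (t # ts) = [:1, - t:] * residual_poly ts"
  by (simp_all add: residual_poly_def)

lemma poly_residual_poly: "poly (residual_poly ts) y = (\<Prod>t\<leftarrow>ts. 1 - t * y)"
  by (induction ts) (simp_all add: algebra_simps)

lemma poly_residual_poly_0 [simp]: "poly (residual_poly ts) 0 = 1"
  by (induction ts) simp_all

lemma residual_poly_nonzero [simp]: "residual_poly ts \<noteq> 0"
  by (metis poly_0 poly_residual_poly_0 zero_neq_one)

lemma degree_residual_poly: "degree (residual_poly ts) \<le> length ts"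
proof (induction ts)
  case (Cons t ts)
  have "degree (residual_poly (t # ts)) \<le> degree [:1, - t:] + degree (residual_poly ts)"
    unfolding residual_poly_Cons by (rule degree_mult_le)
  also have "\<dots> \<le> length (t # ts)" using Cons by simp
  finally show ?case .
qed simp

lemma proots_residual_poly:
  "proots (residual_poly ts) = image_mset inverse (filter_mset (\<lambda>t. t \<noteq> 0) (mset ts))"
proof (induction ts)
  case (Cons t ts)
  have "proots [:1, - t:] = (if t = 0 then {#} else {#inverse t#})"
  proof (cases "t = 0")
    case False
    then have "[:1, - t:] = smult (- t) [:- inverse t, 1:]" by simp
    with False show ?thesis by (simp only: proots_smult proots_linear_factor) simp
  qed simp
  moreover have "[:1, - t:] \<noteq> 0" by simp
  ultimately show ?case
    by (simp only: residual_poly_Cons proots_mult residual_poly_nonzero not_False_eq_True Cons) simp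
qed simp

lemma mset_eq_if_residual_poly_eq:
  assumes "residual_poly ss = residual_poly ts" "length ss = length ts"
  shows "mset ss = mset ts"
proof -
  let ?nz = "\<lambda>us. filter_mset (\<lambda>t. t \<noteq> 0) (mset us :: real multiset)"
  have split: "mset us = ?nz us + replicate_mset (length us - size (?nz us)) 0" for us
  proof -
    have u: "mset us = ?nz us + replicate_mset (count (mset us) 0) 0"
      using multiset_partition[of "mset us" "\<lambda>t. t \<noteq> 0"] by (simp add: filter_eq_replicate_mset)
    then have "size (mset us) = size (?nz us) + count (mset us) 0"
      by (metis size_replicate_mset size_union)
    with u show ?thesis by simp
  qed
  have "image_mset inverse (image_mset inverse (?nz ss)) = image_mset inverse (image_mset inverse (?nz ts))"
    using assms(1) by (metis proots_residual_poly)
  then have "?nz ss = ?nz ts"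
    by (simp add: image_mset.compositionality comp_def)
  then show ?thesis using split[of ss] split[of ts] assms(2) by simp
qed

lemma residual_poly_eq_if_mset_eq: "mset ss = mset ts \<Longrightarrow> residual_poly ss = residual_poly ts"
  unfolding residual_poly_def by (metis mset_map prod_mset_prod_list)

lemma quadratic_pos:
  fixes y :: real
  assumes "u\<^sup>2 < 4 * v" "y \<noteq> 0"
  shows "1 - u * y + v * y\<^sup>2 > 0"
proof -
  have "1 - u * y + v * y\<^sup>2 = (1 - u * y / 2)\<^sup>2 + (v - u\<^sup>2 / 4) * y\<^sup>2"
    by (simp add: power2_eq_square field_simps)
  moreover have "(v - u\<^sup>2 / 4) * y\<^sup>2 > 0" using assms by simp
  ultimately show ?thesis by (simp add: add_nonneg_pos)
qed

lemma real_quadratic_splits: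
  fixes u v :: real
  assumes "u\<^sup>2 \<ge> 4 * v"
  obtains s t where "s + t = u" "s * t = v"
proof
  let ?r = "sqrt (u\<^sup>2 - 4 * v)"
  show "(u + ?r) / 2 + (u - ?r) / 2 = u" by (simp add: field_simps)
  have "?r * ?r = u\<^sup>2 - 4 * v" using assms by simp
  then show "(u + ?r) / 2 * ((u - ?r) / 2) = v" by (simp add: power2_eq_square algebra_simps)
qed

lemma quadratic_formula_Vieta:
  fixes g p n D :: real
  assumes "g \<noteq> 0" "D \<ge> 0" "D = p\<^sup>2 - 4 * n * g"
  shows "(p + sqrt D) / (2 * g) + (p - sqrt D) / (2 * g) = p / g"
    and "(p + sqrt D) / (2 * g) * ((p - sqrt D) / (2 * g)) = n / g"
proof -
  show "(p + sqrt D) / (2 * g) + (p - sqrt D) / (2 * g) = p / g"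
    using assms(1) by (simp add: field_simps)
  have "(p + sqrt D) * (p - sqrt D) = p\<^sup>2 - D"
    using assms(2) by (simp add: power2_eq_square algebra_simps)
  then have "(p + sqrt D) * (p - sqrt D) = 4 * n * g"
    using assms(3) by simp
  then show "(p + sqrt D) / (2 * g) * ((p - sqrt D) / (2 * g)) = n / g"
    using assms(1) by (simp add: times_divide_times_eq)
qed

lemma real_cubic_has_root:
  fixes u v w :: real
  obtains r where "r ^ 3 - u * r\<^sup>2 + v * r - w = 0"
proof -
  obtain m where m: "\<And>y. y \<ge> m \<Longrightarrow> poly [:- w, v, - u, 1:] y \<ge> 1"
    using poly_pinfty_gt_lc[of "[:- w, v, - u, 1:]"] by auto
  obtain n where n: "\<And>y. y \<ge> n \<Longrightarrow> poly [:w, v, u, 1:] y \<ge> 1"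
    using poly_pinfty_gt_lc[of "[:w, v, u, 1:]"] by auto
  define y where "y = max 1 (max m n)"
  have y: "y \<ge> m" "y \<ge> n" "- y < y" by (simp_all add: y_def)
  have "poly [:- w, v, - u, 1:] y > 0"
    using m[OF y(1)] by linarith
  moreover have "poly [:- w, v, - u, 1:] (- y) = - poly [:w, v, u, 1:] y"
    by (simp add: algebra_simps)
  then have "poly [:- w, v, - u, 1:] (- y) < 0"
    using n[OF y(2)] by linarith
  ultimately obtain r where "poly [:- w, v, - u, 1:] r = 0"
    using poly_IVT_pos[OF y(3)] by blast
  then show ?thesis
    by (intro that[of r]) (simp add: power2_eq_square power3_eq_cube algebra_simps)
qed

locale weighted_nodes =
  fixes w x :: "'n::finite \<Rightarrow> real"
  assumes weight_nonneg: "w j \<ge> 0" and node_pos: "x j > 0"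
begin

definition wsum :: "nat \<Rightarrow> real poly \<Rightarrow> real" where
  "wsum k p = (\<Sum>j\<in>UNIV. w j * x j ^ k * poly p (x j))"

definition moment :: "nat \<Rightarrow> real" where
  "moment k = (\<Sum>j\<in>UNIV. x j ^ k * w j)"

definition node_count :: nat where
  "node_count = card (x ` {j. w j \<noteq> 0})"

definition risk :: "real list \<Rightarrow> real" where
  "risk ts = wsum 0 ((residual_poly ts)\<^sup>2)"

lemma wsum_0 [simp]: "wsum k 0 = 0"
  by (simp add: wsum_def)

lemma wsum_pCons: "wsum k (pCons c p) = c * moment k + wsum (Suc k) p"
  by (simp add: wsum_def moment_def sum_distrib_left distrib_left mult_ac flip: sum.distrib)

lemma wsum_add: "wsum k (p + q) = wsum k p + wsum k q"
  by (simp add: wsum_def distrib_left sum.distrib)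

lemma wsum_shift: "wsum k (pCons 0 p) = wsum (Suc k) p"
  by (simp add: wsum_pCons)

lemma wsum_mult: "wsum k (p * q) = (\<Sum>i\<le>degree p. coeff p i * wsum (k + i) q)"
proof -
  have "wsum k (p * q) = (\<Sum>j\<in>UNIV. \<Sum>i\<le>degree p. w j * x j ^ k * (coeff p i * x j ^ i) * poly q (x j))"
    by (simp add: wsum_def poly_altdef[of p] sum_distrib_left sum_distrib_right mult_ac)
  also have "\<dots> = (\<Sum>i\<le>degree p. coeff p i * wsum (k + i) q)"
    by (subst sum.swap) (simp add: wsum_def sum_distrib_left power_add mult_ac)
  finally show ?thesis .
qed

lemma zero_if_sum_zero:
  assumes "(\<Sum>j\<in>UNIV. w j * h j) = 0" and "\<And>j. h j \<ge> 0"
    and "\<And>j. h j = 0 \<Longrightarrow> poly p (x j) = 0" and "degree p < node_count"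
  shows "p = 0"
proof (rule poly_eqI_degree)
  fix y assume "y \<in> x ` {j. w j \<noteq> 0}"
  then obtain j where j: "y = x j" "w j \<noteq> 0" by blast
  have "w j * h j = 0"
    using assms(1,2) weight_nonneg by (subst (asm) sum_nonneg_eq_0_iff) auto
  then show "poly p y = poly 0 y" using j assms(3) by simp
qed (use assms(4) in \<open>auto simp: node_count_def\<close>)

lemma wsum_square_pos:
  assumes "p \<noteq> 0" "degree p < node_count"
  shows "wsum k (p\<^sup>2) > 0"
proof -
  have nz: "x j \<noteq> 0" and nn: "x j \<ge> 0" for j using node_pos[of j] by simp_all
  have "wsum k (p\<^sup>2) \<noteq> 0"
    using zero_if_sum_zero[of "\<lambda>j. x j ^ k * (poly p (x j))\<^sup>2" p] assms nz nn
    by (auto simp: wsum_def mult.assoc)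
  moreover have "wsum k (p\<^sup>2) \<ge> 0"
    unfolding wsum_def using weight_nonneg nn by (intro sum_nonneg) simp
  ultimately show ?thesis by simp
qed

definition orthogonal_upto :: "nat \<Rightarrow> real poly \<Rightarrow> bool" where
  "orthogonal_upto n q \<longleftrightarrow> (\<forall>i<n. wsum (Suc i) q = 0)"

lemma orthogonal_upto_mult:
  assumes "orthogonal_upto n q" "degree p < n"
  shows "wsum 1 (p * q) = 0"
  using assms by (simp add: wsum_mult orthogonal_upto_def)

lemma risk_minimal:
  assumes orth: "orthogonal_upto (length ts) (residual_poly ts)"
    and count: "length ts \<le> node_count" and len: "length ss = length ts"
  shows "risk ts \<le> risk ss" and "risk ss = risk ts \<longleftrightarrow> mset ss = mset ts"
proof -
  define q where "q = residual_poly ts"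
  obtain c p where cp: "residual_poly ss - q = pCons c p"
    by (rule pCons_cases)
  have "c = poly (pCons c p) 0" by simp
  also have "\<dots> = 0" by (simp add: q_def flip: cp)
  finally have c: "c = 0" .
  have deg: "degree p < length ts" if "p \<noteq> 0"
  proof -
    have "degree (pCons c p) \<le> length ts"
      unfolding cp[symmetric] q_def using len degree_residual_poly
      by (intro degree_diff_le) (metis, blast)
    with that show ?thesis by simp
  qed
  have cross: "wsum 1 (p * q) = 0"
    using orthogonal_upto_mult[OF orth deg] unfolding q_def by (cases "p = 0") auto
  have "residual_poly ss = q + pCons 0 p" using cp c by (simp add: algebra_simps)
  then have "(residual_poly ss)\<^sup>2 = q\<^sup>2 + pCons 0 (p * q) + pCons 0 (p * q) + pCons 0 (pCons 0 (p\<^sup>2))"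
    by (simp add: power2_eq_square distrib_left distrib_right mult.commute add.assoc)
  moreover have "wsum 1 (2 * (p * q)) = 0"
    by (simp only: mult_2 wsum_add cross)
  ultimately have eq: "risk ss = risk ts + wsum 2 (p\<^sup>2)"
    by (simp add: risk_def q_def wsum_add wsum_shift numeral_2_eq_2)
  have pos: "wsum 2 (p\<^sup>2) > 0" if "p \<noteq> 0"
    using wsum_square_pos[of p 2] deg[OF that] count that by simp
  show "risk ts \<le> risk ss" using eq pos by (cases "p = 0") auto
  show "risk ss = risk ts \<longleftrightarrow> mset ss = mset ts"
  proof
    assume "risk ss = risk ts"
    then have "p = 0" using eq pos by fastforce
    then have "residual_poly ss = residual_poly ts"
      using cp c by (simp add: q_def)
    then show "mset ss = mset ts" using len by (rule mset_eq_if_residual_poly_eq)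
  next
    assume "mset ss = mset ts"
    then have "residual_poly ss = residual_poly ts" by (rule residual_poly_eq_if_mset_eq)
    then show "risk ss = risk ts" by (simp add: risk_def)
  qed
qed

lemma is_arg_min_risk_iff:
  assumes "orthogonal_upto (length ts) (residual_poly ts)" "length ts \<le> node_count"
  shows "is_arg_min risk (\<lambda>ss. length ss = length ts) ss \<longleftrightarrow> mset ss = mset ts"
proof
  assume "is_arg_min risk (\<lambda>ss. length ss = length ts) ss"
  then have len: "length ss = length ts" and "risk ss \<le> risk ts"
    by (auto simp: is_arg_min_def not_less)
  then have "risk ss = risk ts"
    using risk_minimal(1)[OF assms len] by simp
  then show "mset ss = mset ts"
    using risk_minimal(2)[OF assms len] by simp
next
  assume eq: "mset ss = mset ts"
  then have len: "length ss = length ts" by (rule mset_eq_length)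
  have "risk ss = risk ts" using risk_minimal(2)[OF assms len] eq by simp
  then show "is_arg_min risk (\<lambda>ss. length ss = length ts) ss"
    using risk_minimal(1)[OF assms] len by (auto simp: is_arg_min_def not_less)
qed

text \<open>If \<open>t \<le> 0\<close>, the factor \<open>1 - t y\<close> is positive at all nodes, so orthogonality to the remaining
  factor \<open>r\<close> forces \<open>r\<close> to vanish at too many nodes. A quadratic factor without real roots is
  excluded in the same way.\<close>

lemma step_size_pos:
  assumes orth: "orthogonal_upto (length ts) (residual_poly ts)"
    and count: "length ts \<le> node_count" and t: "t \<in> set ts"
  shows "t > 0"
proof (rule ccontr)
  assume "\<not> t > 0"
  then have le: "t \<le> 0" by simp
  define r where "r = residual_poly (remove1 t ts)"
  have "mset ts = mset (t # remove1 t ts)" using t by simp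
  then have q: "residual_poly ts = [:1, - t:] * r"
    unfolding r_def by (metis residual_poly_Cons residual_poly_eq_if_mset_eq)
  have len: "length (remove1 t ts) < length ts"
    using t by (metis One_nat_def diff_less length_pos_if_in_set length_remove1 zero_less_one)
  then have deg: "degree r < length ts"
    unfolding r_def using degree_residual_poly le_less_trans by blast
  have "t * x j \<le> 0" for j using le node_pos[of j] by (simp add: mult_nonpos_nonneg)
  then have pos: "x j * (1 - t * x j) > 0" for j
    using node_pos[of j] by (smt (verit) zero_less_mult_iff)
  have "(\<Sum>j\<in>UNIV. w j * (x j * (1 - t * x j) * (poly r (x j))\<^sup>2)) = 0"
    using orthogonal_upto_mult[OF orth deg]
    by (simp add: wsum_def q power2_eq_square algebra_simps)
  then have "r = 0"
    using zero_if_sum_zero[of "\<lambda>j. x j * (1 - t * x j) * (poly r (x j))\<^sup>2" r] pos deg count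
    by (smt (verit) mult_eq_0_iff mult_nonneg_nonneg power2_eq_square zero_le_power2 less_le_trans)
  then show False by (simp add: r_def)
qed

lemma no_complex_roots:
  assumes orth: "orthogonal_upto n (p * [:1, - u, v:])"
    and deg: "p \<noteq> 0" "degree p < n" "n \<le> node_count"
  shows "u\<^sup>2 \<ge> 4 * v"
proof (rule ccontr)
  assume "\<not> u\<^sup>2 \<ge> 4 * v"
  then have "1 - u * x j + v * (x j)\<^sup>2 > 0" for j
    using node_pos[of j] by (intro quadratic_pos) auto
  then have pos: "x j * (1 - u * x j + v * (x j)\<^sup>2) > 0" for j
    using node_pos by simp
  have "(\<Sum>j\<in>UNIV. w j * (x j * (1 - u * x j + v * (x j)\<^sup>2) * (poly p (x j))\<^sup>2)) = 0"
    using orthogonal_upto_mult[OF orth deg(2)]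
    by (simp add: wsum_def power2_eq_square algebra_simps)
  then have "p = 0"
    using zero_if_sum_zero[of "\<lambda>j. x j * (1 - u * x j + v * (x j)\<^sup>2) * (poly p (x j))\<^sup>2" p] pos deg
    by (smt (verit) mult_eq_0_iff mult_nonneg_nonneg power2_eq_square zero_le_power2 less_le_trans)
  with deg show False by simp
qed

lemma orthogonal_quadratic_splits:
  assumes "orthogonal_upto 2 [:1, - u, v:]" "2 \<le> node_count"
  shows "u\<^sup>2 \<ge> 4 * v"
  using no_complex_roots[of 2 1 u v] assms by simp

lemma orthogonal_cubic_splits:
  assumes orth: "orthogonal_upto 3 [:1, - u, v, - s:]" and count: "3 \<le> node_count"
  obtains t1 t2 t3 where "residual_poly [t1, t2, t3] = [:1, - u, v, - s:]"
proof -
  obtain r where r: "r ^ 3 - u * r\<^sup>2 + v * r - s = 0"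
    by (rule real_cubic_has_root)
  define \<alpha> where "\<alpha> = u - r"
  define \<beta> where "\<beta> = v - r * \<alpha>"
  have s: "s = r * \<beta>"
    using r by (simp add: \<alpha>_def \<beta>_def power2_eq_square power3_eq_cube algebra_simps)
  have q: "[:1, - u, v, - s:] = [:1, - r:] * [:1, - \<alpha>, \<beta>:]"
    by (simp add: s \<alpha>_def \<beta>_def algebra_simps)
  have "\<alpha>\<^sup>2 \<ge> 4 * \<beta>"
    using no_complex_roots[of 3 "[:1, - r:]" \<alpha> \<beta>] orth count unfolding q by simp
  then obtain t2 t3 where t: "t2 + t3 = \<alpha>" "t2 * t3 = \<beta>"
    by (rule real_quadratic_splits)
  have "residual_poly [r, t2, t3] = [:1, - r:] * [:1, - \<alpha>, \<beta>:]"
    by (simp add: algebra_simps flip: t)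
  then show ?thesis using that q by metis
qed

lemma gram2_pos:
  assumes "2 \<le> node_count"
  shows "moment 2 * moment 4 - (moment 3)\<^sup>2 > 0"
proof -
  \<comment> \<open>\<open>(-c, b)\<close> is mapped to \<open>(0, bd - c\<^sup>2)\<close> by the Gram matrix of \<open>y, y\<^sup>2\<close>\<close>
  let ?b = "moment 2" and ?c = "moment 3" and ?d = "moment 4"
  have b: "?b > 0"
    using wsum_square_pos[of "[:1:]" 2] assms by (simp add: power2_eq_square wsum_pCons)
  have "wsum 2 ([:- ?c, ?b:]\<^sup>2) > 0"
    using b assms by (intro wsum_square_pos) auto
  also have "wsum 2 ([:- ?c, ?b:]\<^sup>2) = ?b * (?b * ?d - ?c\<^sup>2)"
    by (simp add: power2_eq_square wsum_pCons algebra_simps)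
  finally show ?thesis using b by (simp add: zero_less_mult_iff)
qed

lemma gram3_pos:
  fixes b c d e f :: real
  defines "b \<equiv> moment 2" and "c \<equiv> moment 3" and "d \<equiv> moment 4"
    and "e \<equiv> moment 5" and "f \<equiv> moment 6"
  assumes count: "3 \<le> node_count"
  shows "b*d*f + 2*c*d*e - d^3 - c^2*f - b*e^2 > 0" (is "?G > 0")
proof -
  note defs = b_def c_def d_def e_def f_def
  have m: "b*d - c^2 > 0" using gram2_pos count by (simp add: defs)
  \<comment> \<open>the cross product of the first two rows of the Gram matrix of \<open>y, y\<^sup>2, y\<^sup>3\<close>, which the matrix maps to \<open>(0, 0, G)\<close>\<close>
  let ?p = "[:c*e - d^2, c*d - b*e, b*d - c^2:]"
  have "wsum 2 (?p\<^sup>2) > 0"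
    using m count by (intro wsum_square_pos) auto
  also have "wsum 2 (?p\<^sup>2) = (b*d - c^2) * ?G"
    unfolding power2_eq_square[of ?p]
    by (simp add: wsum_pCons flip: defs) algebra
  finally show ?thesis using m by (simp add: zero_less_mult_iff)
qed

lemma two_step_solution:
  fixes a b c d D :: real
  defines "a \<equiv> moment 1" and "b \<equiv> moment 2" and "c \<equiv> moment 3" and "d \<equiv> moment 4"
  defines "D \<equiv> (b*c - a*d)^2 - 4 * (a*c - b^2) * (b*d - c^2)"
  defines "tp \<equiv> (a*d - b*c + sqrt D) / (2 * (b*d - c^2))"
    and "tm \<equiv> (a*d - b*c - sqrt D) / (2 * (b*d - c^2))"
  assumes count: "2 \<le> node_count"
  shows "b*d - c^2 > 0" and "D \<ge> 0" and "orthogonal_upto 2 (residual_poly [tp, tm])"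
proof -
  note defs = a_def b_def c_def d_def
  define u where "u = (a*d - b*c) / (b*d - c^2)"
  define v where "v = (a*c - b^2) / (b*d - c^2)"
  show G: "b*d - c^2 > 0" using gram2_pos[OF count] by (simp add: defs)
  have u: "u * (b*d - c^2) = a*d - b*c" and v: "v * (b*d - c^2) = a*c - b^2"
    using G by (simp_all add: u_def v_def)
  have "(b*d - c^2) * (a - u * b + v * c) = 0" using u v by algebra
  moreover have "(b*d - c^2) * (b - u * c + v * d) = 0" using u v by algebra
  ultimately have orth: "orthogonal_upto 2 [:1, - u, v:]"
    using G by (simp add: orthogonal_upto_def numeral_2_eq_2 All_less_Suc wsum_pCons)
      (simp add: defs numeral_2_eq_2 numeral_3_eq_3 numeral_eq_Suc)
  have D: "D = (b*d - c^2)^2 * (u^2 - 4 * v)"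
    unfolding D_def using u v by algebra
  then show "D \<ge> 0"
    using orthogonal_quadratic_splits[OF orth count] by simp
  moreover have "D = (a*d - b*c)^2 - 4 * (a*c - b^2) * (b*d - c^2)"
    by (simp add: D_def power2_commute)
  ultimately have "tp + tm = u" "tp * tm = v"
    using quadratic_formula_Vieta[of "b*d - c^2" D "a*d - b*c" "a*c - b^2"] G
    by (simp_all add: tp_def tm_def u_def v_def)
  then have "residual_poly [tp, tm] = [:1, - u, v:]"
    by (simp add: algebra_simps)
  with orth show "orthogonal_upto 2 (residual_poly [tp, tm])" by simp
qed

lemma three_step_solution:
  fixes a b c d e f d0 d1 d2 d3 :: real
  defines "a \<equiv> moment 1" and "b \<equiv> moment 2" and "c \<equiv> moment 3"
    and "d \<equiv> moment 4" and "e \<equiv> moment 5" and "f \<equiv> moment 6"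
  defines "d0 \<equiv> a*c*e - b^2*e - a*d^2 + 2*b*c*d - c^3"
    and "d1 \<equiv> c^2*d - b*d^2 - b*c*e + a*d*e + b^2*f - a*c*f"
    and "d2 \<equiv> - c*d^2 + c^2*e + b*d*e - a*e^2 - b*c*f + a*d*f"
    and "d3 \<equiv> d^3 - 2*c*d*e + b*e^2 + c^2*f - b*d*f"
  assumes count: "3 \<le> node_count"
  shows "d3 < 0"
    and "\<exists>t1 t2 t3. orthogonal_upto 3 (residual_poly [t1, t2, t3]) \<and>
      d2 = - d3 * (t1 + t2 + t3) \<and> d1 = d3 * (t1 * t2 + t1 * t3 + t2 * t3) \<and> d0 = - d3 * (t1 * t2 * t3)"
proof -
  note defs = a_def b_def c_def d_def e_def f_def
  note dd = d0_def d1_def d2_def d3_def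
  show neg: "d3 < 0" using gram3_pos[OF count] by (simp add: d3_def defs)
  define u where "u = - d2 / d3"
  define v where "v = d1 / d3"
  define s where "s = - d0 / d3"
  have uvs: "d2 = - d3 * u" "d1 = d3 * v" "d0 = - d3 * s"
    using neg by (simp_all add: u_def v_def s_def)
  have "d3 * (a - u * b + v * c - s * d) = a * d3 + b * d2 + c * d1 + d * d0"
    using uvs by algebra
  also have "\<dots> = 0" unfolding dd by algebra
  finally have 1: "a - u * b + v * c - s * d = 0" using neg by simp
  have "d3 * (b - u * c + v * d - s * e) = b * d3 + c * d2 + d * d1 + e * d0"
    using uvs by algebra
  also have "\<dots> = 0" unfolding dd by algebra
  finally have 2: "b - u * c + v * d - s * e = 0" using neg by simp
  have "d3 * (c - u * d + v * e - s * f) = c * d3 + d * d2 + e * d1 + f * d0"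
    using uvs by algebra
  also have "\<dots> = 0" unfolding dd by algebra
  finally have 3: "c - u * d + v * e - s * f = 0" using neg by simp
  have orth: "orthogonal_upto 3 [:1, - u, v, - s:]"
    using 1 2 3 by (simp add: orthogonal_upto_def numeral_3_eq_3 All_less_Suc wsum_pCons)
      (simp add: defs numeral_eq_Suc)
  obtain t1 t2 t3 where t: "residual_poly [t1, t2, t3] = [:1, - u, v, - s:]"
    using orthogonal_cubic_splits[OF orth count] .
  then have "u = t1 + t2 + t3" "v = t1 * t2 + t1 * t3 + t2 * t3" "s = t1 * t2 * t3"
    by (simp_all add: algebra_simps)
  then show "\<exists>t1 t2 t3. orthogonal_upto 3 (residual_poly [t1, t2, t3]) \<and>
      d2 = - d3 * (t1 + t2 + t3) \<and> d1 = d3 * (t1 * t2 + t1 * t3 + t2 * t3) \<and> d0 = - d3 * (t1 * t2 * t3)"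
    using orth uvs unfolding t[symmetric] by blast
qed

end

theorem theorem6:
  fixes P Q \<Sigma> :: "real^'n^'n" and lam \<mu> :: "real^'n" and X :: "(real^'n) measure"
    and \<theta> :: "nat \<Rightarrow> real" and k :: nat
    and z :: "'n \<Rightarrow> real" and a b c d e f d0 d1 d2 d3 :: real
  assumes P_pd: "sym_pos_def P"
    and Q_orth: "orthogonal_matrix Q"
    and eig: "P = Q ** diag_matrix lam ** transpose Q"
    and lam_pos: "\<And>j. lam $ j > 0"
    and X: "gaussian_law X \<mu> \<Sigma>"
    and z: "z = zbar Q lam \<mu> \<Sigma> \<theta> k"
    and a: "a = (\<Sum>j\<in>UNIV. lam $ j * z j)"
    and b: "b = (\<Sum>j\<in>UNIV. (lam $ j)^2 * z j)"
    and c: "c = (\<Sum>j\<in>UNIV. (lam $ j)^3 * z j)"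
    and d: "d = (\<Sum>j\<in>UNIV. (lam $ j)^4 * z j)"
    and e: "e = (\<Sum>j\<in>UNIV. (lam $ j)^5 * z j)"
    and f: "f = (\<Sum>j\<in>UNIV. (lam $ j)^6 * z j)"
    and d0: "d0 = a*c*e - b^2*e - a*d^2 + 2*b*c*d - c^3"
    and d1: "d1 = c^2*d - b*d^2 - b*c*e + a*d*e + b^2*f - a*c*f"
    and d2: "d2 = - c*d^2 + c^2*e + b*d*e - a*e^2 - b*c*f + a*d*f"
    and d3: "d3 = d^3 - 2*c*d*e + b*e^2 + c^2*f - b*d*f"
  shows "(\<forall>B\<ge>1. \<forall>ts. length ts = B \<longrightarrow>
           integrable X (lookahead_error P \<theta> k ts) \<and>
           lookahead_risk P X \<theta> k ts =
             (\<Sum>j\<in>UNIV. (\<Prod>i<B. (1 - ts ! i * lam $ j)^2) * z j)) \<and>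
         ((\<exists>i j. z i \<noteq> 0 \<and> z j \<noteq> 0 \<and> lam $ i \<noteq> lam $ j) \<longrightarrow>
           (let D = (b*c - a*d)^2 - 4 * (a*c - b^2) * (b*d - c^2);
                tp = (a*d - b*c + sqrt D) / (2 * (b*d - c^2));
                tm = (a*d - b*c - sqrt D) / (2 * (b*d - c^2))
            in b*d - c^2 \<noteq> 0 \<and> D \<ge> 0 \<and> tp \<ge> 0 \<and> tm \<ge> 0 \<and>
               lookahead_minimizers P X \<theta> k 2 = {ts. mset ts = {#tp, tm#}})) \<and>
         ((\<exists>i j l. z i \<noteq> 0 \<and> z j \<noteq> 0 \<and> z l \<noteq> 0 \<and>
                  lam $ i \<noteq> lam $ j \<and> lam $ i \<noteq> lam $ l \<and> lam $ j \<noteq> lam $ l) \<longrightarrow>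
           d3 \<noteq> 0 \<and>
           (\<exists>t1 t2 t3 :: real.
              (\<forall>t::complex. of_real d3 * t^3 + of_real d2 * t^2 + of_real d1 * t + of_real d0 =
                 of_real d3 * (t - of_real t1) * (t - of_real t2) * (t - of_real t3)) \<and>
              lookahead_minimizers P X \<theta> k 3 = {ts. mset ts = {#t1, t2, t3#}}))"
proof -
  interpret weighted_nodes z "\<lambda>j. lam $ j"
    by unfold_locales (simp_all add: z zbar_nonneg[OF X] lam_pos)
  have moments: "a = moment 1" "b = moment 2" "c = moment 3" "d = moment 4" "e = moment 5" "f = moment 6"
    by (simp_all add: moment_def a b c d e f)
  have expected: "has_bochner_integral X (lookahead_error P \<theta> k ts) (risk ts)" for ts
    using lookahead_error_has_integral[OF P_pd Q_orth eig lam_pos X, of \<theta> k ts, folded z]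
    by (simp add: risk_def wsum_def poly_residual_poly mult.commute)
  then have risk: "lookahead_risk P X \<theta> k = risk"
    by (simp add: fun_eq_iff lookahead_risk_def has_bochner_integral_iff)
  have formula: "risk ts = (\<Sum>j\<in>UNIV. (\<Prod>i<length ts. (1 - ts ! i * lam $ j)^2) * z j)" for ts
    by (simp add: risk_def wsum_def poly_residual_poly prod.list_conv_set_nth
        atLeast0LessThan prod_power_distrib mult.commute)
  have minimizers: "lookahead_minimizers P X \<theta> k (length ts) = {ss. mset ss = mset ts}"
    if "orthogonal_upto (length ts) (residual_poly ts)" "length ts \<le> node_count" for ts
    by (auto simp: lookahead_minimizers_def risk is_arg_min_risk_iff[OF that])
  have nodes: "card ((\<lambda>j. lam $ j) ` S) \<le> node_count" if "\<And>j. j \<in> S \<Longrightarrow> z j \<noteq> 0" for S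
    unfolding node_count_def using that by (intro card_mono image_mono) auto
  show ?thesis
  proof (intro conjI impI)
    show "\<forall>B\<ge>1. \<forall>ts. length ts = B \<longrightarrow>
           integrable X (lookahead_error P \<theta> k ts) \<and>
           lookahead_risk P X \<theta> k ts =
             (\<Sum>j\<in>UNIV. (\<Prod>i<B. (1 - ts ! i * lam $ j)^2) * z j)"
      using expected formula by (simp add: risk has_bochner_integral_iff)
  next
    assume "\<exists>i j. z i \<noteq> 0 \<and> z j \<noteq> 0 \<and> lam $ i \<noteq> lam $ j"
    then obtain i j where ij: "z i \<noteq> 0" "z j \<noteq> 0" "lam $ i \<noteq> lam $ j" by blast
    have "card ((\<lambda>j. lam $ j) ` {i, j}) \<le> node_count"
      by (rule nodes) (use ij in auto)
    then have count: "2 \<le> node_count" using ij by simp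
    define D where "D = (b*c - a*d)^2 - 4 * (a*c - b^2) * (b*d - c^2)"
    define tp where "tp = (a*d - b*c + sqrt D) / (2 * (b*d - c^2))"
    define tm where "tm = (a*d - b*c - sqrt D) / (2 * (b*d - c^2))"
    note solution = two_step_solution[OF count, folded moments, folded D_def, folded tp_def tm_def]
    have orth: "orthogonal_upto (length [tp, tm]) (residual_poly [tp, tm])"
      using solution(3) by (simp add: numeral_2_eq_2)
    have "tp > 0" "tm > 0"
      using step_size_pos[OF orth] count by simp_all
    moreover have "lookahead_minimizers P X \<theta> k 2 = {ts. mset ts = {#tp, tm#}}"
      using minimizers[OF orth] count by (simp add: numeral_2_eq_2)
    ultimately show "let D = (b*c - a*d)^2 - 4 * (a*c - b^2) * (b*d - c^2);
                tp = (a*d - b*c + sqrt D) / (2 * (b*d - c^2));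
                tm = (a*d - b*c - sqrt D) / (2 * (b*d - c^2))
            in b*d - c^2 \<noteq> 0 \<and> D \<ge> 0 \<and> tp \<ge> 0 \<and> tm \<ge> 0 \<and>
               lookahead_minimizers P X \<theta> k 2 = {ts. mset ts = {#tp, tm#}}"
      unfolding Let_def D_def[symmetric] tp_def[symmetric] tm_def[symmetric] using solution by auto
  next
    assume "\<exists>i j l. z i \<noteq> 0 \<and> z j \<noteq> 0 \<and> z l \<noteq> 0 \<and>
                  lam $ i \<noteq> lam $ j \<and> lam $ i \<noteq> lam $ l \<and> lam $ j \<noteq> lam $ l"
    then obtain i j l where ijl: "z i \<noteq> 0" "z j \<noteq> 0" "z l \<noteq> 0"
      "lam $ i \<noteq> lam $ j" "lam $ i \<noteq> lam $ l" "lam $ j \<noteq> lam $ l" by blast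
    have "card ((\<lambda>j. lam $ j) ` {i, j, l}) \<le> node_count"
      by (rule nodes) (use ijl in auto)
    then have count: "3 \<le> node_count" using ijl by simp
    note solution = three_step_solution[OF count, folded moments, folded d0 d1 d2 d3]
    show "d3 \<noteq> 0" using solution(1) by simp
    obtain t1 t2 t3 where
      orth: "orthogonal_upto (length [t1, t2, t3]) (residual_poly [t1, t2, t3])"
      and coeffs: "d2 = - d3 * (t1 + t2 + t3)" "d1 = d3 * (t1 * t2 + t1 * t3 + t2 * t3)"
        "d0 = - d3 * (t1 * t2 * t3)"
      using solution(2) by (auto simp: numeral_3_eq_3)
    have "of_real d3 * t^3 + of_real d2 * t^2 + of_real d1 * t + of_real d0 =
        of_real d3 * (t - of_real t1) * (t - of_real t2) * (t - of_real t3)" for t :: complex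
      unfolding coeffs by (simp add: power2_eq_square power3_eq_cube algebra_simps)
    moreover have "lookahead_minimizers P X \<theta> k 3 = {ts. mset ts = {#t1, t2, t3#}}"
      using minimizers[OF orth] count by (simp add: numeral_3_eq_3)
    ultimately show "\<exists>t1 t2 t3 :: real.
              (\<forall>t::complex. of_real d3 * t^3 + of_real d2 * t^2 + of_real d1 * t + of_real d0 =
                 of_real d3 * (t - of_real t1) * (t - of_real t2) * (t - of_real t3)) \<and>
              lookahead_minimizers P X \<theta> k 3 = {ts. mset ts = {#t1, t2, t3#}}"
      by blast
  qed
qed

end
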